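(* Let $g:[0,\infty)\to\mathbb{R}$ be continuous and bounded, let $p_\lambda(u)=u^3-\lambda u$, and let $$\lambda_0=\sup\Big\{\lambda \ge 0:\ |g(t)|\ge p_\lambda\big(-\sqrt{\lambda/3}\,\big)\ \text{for some } t\ge 0\Big\}.$$ If $\lambda>\lambda_0$, then for any $\varepsilon>0$, among the solutions of $$\varepsilon^2u''=u^3-\lambda u+g(t),\qquad u'(0)=0,$$ that are bounded on $[0,\infty)$, there is a unique one with $u>0$ and $3u^2-\lambda>0$ on $[0,\infty)$, and there is another one, also unique, with $u<0$ and $3u^2-\lambda>0$ on $[0,\infty)$. *)

theory Defs
  imports "HOL-Analysis.Analysis"
begin

definition cubic :: "real \<Rightarrow> real \<Rightarrow> real" where
  "cubic lam u = u ^ 3 - lam * u"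

text \<open>The set below always contains 0, and it is bounded above whenever g is bounded on the
  half-line, so the conditionally complete supremum is the intended one.\<close>

definition lambda0 :: "(real \<Rightarrow> real) \<Rightarrow> real" where
  "lambda0 g = Sup {lam. lam \<ge> 0 \<and> (\<exists>t\<ge>0. \<bar>g t\<bar> \<ge> cubic lam (- sqrt (lam / 3)))}"

text \<open>Derivatives are taken within the half-line, hence one-sided at 0 and independent of
  the values of u at negative arguments. For continuous g a twice differentiable solution is
  automatically twice continuously differentiable.\<close>

definition neumann_solution ::
  "real \<Rightarrow> real \<Rightarrow> (real \<Rightarrow> real) \<Rightarrow> (real \<Rightarrow> real) \<Rightarrow> bool" where
  "neumann_solution \<epsilon> lam g u \<longleftrightarrow>
     (\<exists>u' u''.
        (\<forall>t\<ge>0. (u has_real_derivative u' t) (at t within {0..})) \<and>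
        (\<forall>t\<ge>0. (u' has_real_derivative u'' t) (at t within {0..})) \<and>
        (\<forall>t\<ge>0. \<epsilon>\<^sup>2 * u'' t = u t ^ 3 - lam * u t + g t) \<and>
        u' 0 = 0)"

definition bounded_neumann_solution ::
  "real \<Rightarrow> real \<Rightarrow> (real \<Rightarrow> real) \<Rightarrow> (real \<Rightarrow> real) \<Rightarrow> bool" where
  "bounded_neumann_solution \<epsilon> lam g u \<longleftrightarrow>
     neumann_solution \<epsilon> lam g u \<and> bounded (u ` {0..})"

text \<open>Unique existence of a function on the half-line: since HOL functions are total, uniqueness
  is up to the irrelevant values at negative arguments.\<close>

definition ex1_halfline :: "((real \<Rightarrow> real) \<Rightarrow> bool) \<Rightarrow> bool" where
  "ex1_halfline P \<longleftrightarrow> (\<exists>u. P u \<and> (\<forall>v. P v \<longrightarrow> (\<forall>t\<ge>0. v t = u t)))"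

end

theory Submission
  imports Defs
begin

text \<open>Write \<open>\<lambda> = 3 s\<^sup>2\<close> with \<open>s > 0\<close>. The local maximum \<open>p(-s) = 2 s\<^sup>3\<close> and minimum
  \<open>p(s) = -2 s\<^sup>3\<close> of \<open>p\<close> bound \<open>g\<close> strictly, so there are constants \<open>s < a < b = 2 s\<close> with
  \<open>p(a) + g \<le> 0 \<le> p(b) + g\<close>. Let \<open>K\<close> be the maximum of \<open>p'\<close> on \<open>[a, b]\<close>. Solving
  \<open>\<epsilon>\<^sup>2 w'' - K w = p(u) - K u + g\<close> for the bounded Neumann solution \<open>w\<close> maps the functions \<open>u\<close> with
  values in \<open>[a, b]\<close> to themselves, because the right-hand side decreases in \<open>u\<close>, and it is a
  contraction, because \<open>p'\<close> has a positive minimum there. For uniqueness, the square of the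
  difference of two solutions is convex, bounded, and flat at 0, hence constant. The negative
  solution comes from the symmetry \<open>(u, g) \<mapsto> (-u, -g)\<close>.\<close>

section \<open>The linear Neumann problem on the half-line\<close>

text \<open>The bounded solution of \<open>w'' = k\<^sup>2 w - f\<close>, \<open>w'(0) = 0\<close>, by variation of constants: the second
  bracket is the tail of the integral from \<open>t\<close> to infinity, and the constant in the first one
  enforces the Neumann condition.\<close>

definition resolvent :: "real \<Rightarrow> (real \<Rightarrow> real) \<Rightarrow> real \<Rightarrow> real" where
  "resolvent k f t =
     (exp (- k * t) * (integral {0..t} (\<lambda>s. exp (k * s) * f s) + integral {0..} (\<lambda>s. exp (- k * s) * f s))
      + exp (k * t) * (integral {0..} (\<lambda>s. exp (- k * s) * f s) - integral {0..t} (\<lambda>s. exp (- k * s) * f s)))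
     / (2 * k)"

definition resolvent_deriv :: "real \<Rightarrow> (real \<Rightarrow> real) \<Rightarrow> real \<Rightarrow> real" where
  "resolvent_deriv k f t =
     (exp (k * t) * (integral {0..} (\<lambda>s. exp (- k * s) * f s) - integral {0..t} (\<lambda>s. exp (- k * s) * f s))
      - exp (- k * t) * (integral {0..t} (\<lambda>s. exp (k * s) * f s) + integral {0..} (\<lambda>s. exp (- k * s) * f s)))
     / 2"

lemma integral_halfline_has_real_derivative:
  fixes f :: "real \<Rightarrow> real"
  assumes "continuous_on {0..} f" "t \<ge> 0"
  shows "((\<lambda>x. integral {0..x} f) has_real_derivative f t) (at t within {0..})"
proof -
  have "((\<lambda>x. integral {0..x} f) has_real_derivative f t) (at t within {0..t + 1})"
    by (rule integral_has_real_derivative)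
       (use assms in \<open>auto intro: continuous_on_subset\<close>)
  \<comment> \<open>Below \<open>t + 1\<close> the two sets agree, and the filter sees only a
    neighbourhood of \<open>t\<close>.\<close>
  moreover have "at t within {0..t + 1} = at t within {0..}"
    by (rule at_within_nhd[where S = "{..<t + 1}"]) auto
  ultimately show ?thesis by simp
qed

lemma integrable_exp_minus_times_bounded:
  fixes f :: "real \<Rightarrow> real"
  assumes "k > 0" "continuous_on {0..} f" "bounded (f ` {0..})"
  shows "(\<lambda>s. exp (- k * s) * f s) integrable_on {0..}"
proof -
  obtain B where B: "\<And>s. s \<ge> 0 \<Longrightarrow> \<bar>f s\<bar> \<le> B"
    using assms(3) by (auto simp: bounded_iff)
  show ?thesis
  proof (rule measurable_bounded_by_integrable_imp_integrable_real)
    show "(\<lambda>s. exp (- k * s) * f s) \<in> borel_measurable (lebesgue_on {0..})"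
      by (intro continuous_imp_measurable_on_sets_lebesgue continuous_intros assms) auto
    show "(\<lambda>s. B * exp (- k * s)) integrable_on {0..}"
      using integrable_on_exp_minus_to_infinity[OF assms(1), of 0]
      by (intro integrable_on_mult_right) auto
    show "\<bar>exp (- k * s) * f s\<bar> \<le> B * exp (- k * s)" if "s \<in> {0..}" for s
      using B[of s] that by (simp add: abs_mult)
  qed auto
qed

text \<open>In the product rule, differentiating the integrals leaves plain \<open>f t\<close>
  terms, as opposite exponentials cancel. These terms cancel in the first derivative and add up to
  \<open>- f t\<close> in the second.\<close>

lemma resolvent_has_derivative:
  assumes "k > 0" "continuous_on {0..} f" "t \<ge> 0"
  shows "(resolvent k f has_real_derivative resolvent_deriv k f t) (at t within {0..})"
    and "(resolvent_deriv k f has_real_derivative k\<^sup>2 * resolvent k f t - f t) (at t within {0..})"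
proof -
  have A: "((\<lambda>x. integral {0..x} (\<lambda>s. exp (k * s) * f s)) has_real_derivative exp (k * t) * f t) (at t within {0..})"
    by (rule integral_halfline_has_real_derivative) (intro continuous_intros assms)+
  have B: "((\<lambda>x. integral {0..x} (\<lambda>s. exp (- k * s) * f s)) has_real_derivative exp (- k * t) * f t) (at t within {0..})"
    by (rule integral_halfline_has_real_derivative) (intro continuous_intros assms)+
  have e': "exp (- (k * t)) * (exp (k * t) * x) = x" "exp (k * t) * (exp (- (k * t)) * x) = x"
    "exp (k * t) * exp (- (k * t)) = 1" for x
    by (simp_all flip: exp_add mult.assoc)
  show "(resolvent k f has_real_derivative resolvent_deriv k f t) (at t within {0..})"
    unfolding resolvent_def[abs_def] resolvent_deriv_def
    by (rule derivative_eq_intros A B refl)+ (use \<open>k > 0\<close> in \<open>simp_all add: field_simps e'\<close>)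
  show "(resolvent_deriv k f has_real_derivative k\<^sup>2 * resolvent k f t - f t) (at t within {0..})"
    unfolding resolvent_def resolvent_deriv_def[abs_def]
    by (rule derivative_eq_intros A B refl)+
      (use \<open>k > 0\<close> in \<open>simp_all add: field_simps e' power2_eq_square\<close>)
qed

lemma resolvent_deriv_0: "resolvent_deriv k f 0 = 0"
  by (simp add: resolvent_deriv_def)

text \<open>With \<open>resolvent_mono\<close>, this turns constant bounds on the right-hand side
  into bounds on the solution.\<close>

lemma resolvent_const:
  assumes "k > 0" "t \<ge> 0"
  shows "resolvent k (\<lambda>_. c) t = c / k\<^sup>2"
proof -
  have A: "integral {0..t} (\<lambda>s. exp (k * s) * c) = exp (k * t) * c / k - exp (k * 0) * c / k"
    by (rule integral_unique, rule fundamental_theorem_of_calculus[OF assms(2)])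
       (use assms in \<open>auto intro!: derivative_eq_intros simp flip: has_real_derivative_iff_has_vector_derivative\<close>)
  have B: "integral {0..t} (\<lambda>s. exp (- k * s) * c) = - exp (- k * t) * c / k - (- exp (- k * 0) * c / k)"
    by (rule integral_unique, rule fundamental_theorem_of_calculus[OF assms(2)])
       (use assms in \<open>auto intro!: derivative_eq_intros simp flip: has_real_derivative_iff_has_vector_derivative\<close>)
  have C: "integral {0..} (\<lambda>s. exp (- k * s) * c) = c / k"
    using has_integral_mult_left[OF has_integral_exp_minus_to_infinity[OF assms(1), of 0], of c]
    by (auto dest!: integral_unique)
  have e': "exp (- (k * t)) * (exp (k * t) * x) = x" "exp (k * t) * (exp (- (k * t)) * x) = x"
    "exp (k * t) * exp (- (k * t)) = 1" for x
    by (simp_all flip: exp_add mult.assoc)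
  show ?thesis
    unfolding resolvent_def A B C using assms by (simp add: field_simps e' power2_eq_square)
qed

lemma resolvent_diff:
  assumes "k > 0" "continuous_on {0..} f" "bounded (f ` {0..})"
    "continuous_on {0..} h" "bounded (h ` {0..})" 
  shows "resolvent k (\<lambda>s. f s - h s) t = resolvent k f t - resolvent k h t"
proof -
  have A: "integral {0..t} (\<lambda>s. exp (c * s) * (f s - h s)) =
     integral {0..t} (\<lambda>s. exp (c * s) * f s) - integral {0..t} (\<lambda>s. exp (c * s) * h s)" for c
    unfolding right_diff_distrib
    by (intro integral_diff integrable_continuous_real continuous_intros)
       (use assms in \<open>auto intro: continuous_on_subset\<close>)
  have C: "integral {0..} (\<lambda>s. exp (- k * s) * (f s - h s)) =
     integral {0..} (\<lambda>s. exp (- k * s) * f s) - integral {0..} (\<lambda>s. exp (- k * s) * h s)"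
    unfolding right_diff_distrib
    by (intro integral_diff integrable_exp_minus_times_bounded assms)
  show ?thesis
    unfolding resolvent_def A C using assms(1) by (simp add: field_simps)
qed

text \<open>A maximum principle read off from the formula: the exponential weights are positive, and
  the second bracket is a tail integral of a nonnegative function.\<close>

lemma resolvent_nonneg:
  assumes "k > 0" "continuous_on {0..} f" "bounded (f ` {0..})" "\<And>s. s \<ge> 0 \<Longrightarrow> f s \<ge> 0"
    "t \<ge> 0"
  shows "resolvent k f t \<ge> 0"
proof -
  note I = integrable_exp_minus_times_bounded[OF assms(1-3)]
  have "integral {0..} (\<lambda>s. exp (- k * s) * f s) \<ge> integral {0..t} (\<lambda>s. exp (- k * s) * f s)"
    by (rule integral_subset_le) (use assms I in \<open>auto intro: integrable_on_subinterval\<close>)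
  moreover have "integral {0..t} (\<lambda>s. exp (c * s) * f s) \<ge> 0" for c
    by (rule integral_nonneg)
       (use assms in \<open>auto intro!: integrable_continuous_real continuous_intros intro: continuous_on_subset\<close>)
  moreover have "integral {0..} (\<lambda>s. exp (- k * s) * f s) \<ge> 0"
    by (rule integral_nonneg) (use assms I in auto)
  ultimately show ?thesis
    unfolding resolvent_def using assms by (intro divide_nonneg_pos add_nonneg_nonneg mult_nonneg_nonneg) auto
qed

lemma resolvent_mono:
  assumes "k > 0" "continuous_on {0..} f" "bounded (f ` {0..})"
    "continuous_on {0..} h" "bounded (h ` {0..})" "\<And>s. s \<ge> 0 \<Longrightarrow> f s \<le> h s" "t \<ge> 0"
  shows "resolvent k f t \<le> resolvent k h t"
proof -
  have "resolvent k (\<lambda>s. h s - f s) t \<ge> 0"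
    by (rule resolvent_nonneg) (use assms in \<open>auto intro!: continuous_intros bounded_minus_comp\<close>)
  thus ?thesis using resolvent_diff[of k h f t] assms by simp
qed

section \<open>Existence between constant barriers\<close>

text \<open>As the slopes of \<open>P\<close> lie between \<open>m\<close> and \<open>L\<close>,
  those of \<open>L * x - P x\<close> lie between 0 and \<open>L - m\<close>. The resolvent with
  \<open>k\<^sup>2 = L\<close> scales constants by \<open>1 / L\<close>, so it preserves the order
  interval and yields the contraction factor \<open>1 - m / L\<close>.\<close>

lemma ex_solution_between_barriers:
  fixes P G :: "real \<Rightarrow> real"
  assumes "a \<le> b" "0 < m" "m \<le> L"
    and P: "continuous_on {a..b} P"
    and lower: "\<And>x y. a \<le> x \<Longrightarrow> x \<le> y \<Longrightarrow> y \<le> b \<Longrightarrow> m * (y - x) \<le> P y - P x"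
    and upper: "\<And>x y. a \<le> x \<Longrightarrow> x \<le> y \<Longrightarrow> y \<le> b \<Longrightarrow> P y - P x \<le> L * (y - x)"
    and G: "continuous_on {0..} G"
    and sub: "\<And>t. t \<ge> 0 \<Longrightarrow> P a + G t \<le> 0"
    and super: "\<And>t. t \<ge> 0 \<Longrightarrow> 0 \<le> P b + G t"
  shows "\<exists>u u'. (\<forall>t\<ge>0. (u has_real_derivative u' t) (at t within {0..})) \<and>
    (\<forall>t\<ge>0. (u' has_real_derivative P (u t) + G t) (at t within {0..})) \<and>
    u' 0 = 0 \<and> (\<forall>t\<ge>0. a \<le> u t \<and> u t \<le> b)"
proof -
  define k where "k = sqrt L"
  have k: "k > 0" "k\<^sup>2 = L" using assms by (auto simp: k_def)
  have "L > 0" using assms by simp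
  define F where "F u t = L * u t - P (u t) - G t" for u :: "real \<Rightarrow> real" and t
  define S :: "(real \<Rightarrow>\<^sub>C real) set" where "S = PiC UNIV (\<lambda>_. {a..b})"
  have S: "u \<in> S \<longleftrightarrow> (\<forall>t. a \<le> u t \<and> u t \<le> b)" for u
    by (auto simp: S_def mem_PiC_iff)
  \<comment> \<open>Since \<open>L * x - P x\<close> is nondecreasing, \<open>F u\<close> is bounded
    by its values at the constants \<open>a\<close> and \<open>b\<close>, where \<open>sub\<close>
    and \<open>super\<close> apply.\<close>
  have Fb: "L * a \<le> F u t" "F u t \<le> L * b" if "u \<in> S" "t \<ge> 0" for u t
    using upper[of a "u t"] upper[of "u t" b] sub[of t] super[of t] that
    by (auto simp: S F_def algebra_simps intro: add_mono)
  have Fc: "continuous_on {0..} (F u)" if "u \<in> S" for u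
    unfolding F_def[abs_def] using that
    by (intro continuous_intros G continuous_on_compose2[OF P]) (auto simp: S)
  have Fbd: "bounded (F u ` {0..})" if "u \<in> S" for u
    by (rule bounded_subset[of "{L * a..L * b}"]) (use Fb that in auto)
  \<comment> \<open>The Banach space consists of functions on the whole line, hence the even extension.\<close>
  define W where "W u t = resolvent k (F u) \<bar>t\<bar>" for u t
  have Wb: "a \<le> W u t \<and> W u t \<le> b" if "u \<in> S" for u t
  proof
    have "resolvent k (\<lambda>_. L * a) \<bar>t\<bar> \<le> W u t" unfolding W_def
      by (rule resolvent_mono) (use that k Fb Fc Fbd in \<open>auto simp: image_constant_conv\<close>)
    thus "a \<le> W u t" using resolvent_const[of k "\<bar>t\<bar>" "L * a"] k \<open>L > 0\<close> by simp
    have "W u t \<le> resolvent k (\<lambda>_. L * b) \<bar>t\<bar>" unfolding W_def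
      by (rule resolvent_mono) (use that k Fb Fc Fbd in \<open>auto simp: image_constant_conv\<close>)
    thus "W u t \<le> b" using resolvent_const[of k "\<bar>t\<bar>" "L * b"] k \<open>L > 0\<close> by simp
  qed
  have Wbc: "W u \<in> bcontfun" if "u \<in> S" for u
  proof -
    have "continuous_on {0..} (resolvent k (F u))"
      by (rule DERIV_continuous_on) (use resolvent_has_derivative(1)[OF k(1) Fc[OF that]] in auto)
    hence "continuous_on UNIV (W u)"
      unfolding W_def[abs_def] by (rule continuous_on_compose2) (auto intro!: continuous_intros)
    moreover have "bounded (range (W u))"
      by (rule bounded_subset[of "{a..b}"]) (use Wb[OF that] in auto)
    ultimately show ?thesis by (simp add: bcontfun_def)
  qed
  \<comment> \<open>\<open>Bcontfun\<close> is inverted only on bounded continuous functions, so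
    \<open>T\<close> is controlled through \<open>Wbc\<close> on \<open>S\<close> alone.\<close>
  define T where "T u = Bcontfun (W (apply_bcontfun u))" for u
  have T: "apply_bcontfun (T u) = W u" if "u \<in> S" for u
    unfolding T_def by (rule Bcontfun_inverse) (use Wbc that in auto)
  \<comment> \<open>A one-sided bound suffices, as exchanging \<open>u\<close> and \<open>v\<close>
    gives the other side.\<close>
  have le: "W u t \<le> W v t + (1 - m / L) * dist u v" if "u \<in> S" "v \<in> S" for u v t
  proof -
    define d where "d = (L - m) * dist u v"
    have "F u s - F v s \<le> d" if "s \<ge> 0" for s
    proof -
      have uv: "a \<le> u s" "u s \<le> b" "a \<le> v s" "v s \<le> b"
        using \<open>u \<in> S\<close> \<open>v \<in> S\<close> by (auto simp: S)
      have D: "\<bar>u s - v s\<bar> \<le> dist u v"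
        using dist_bounded[of u s v] by (simp add: dist_real_def)
      have "F u s - F v s = L * (u s - v s) - (P (u s) - P (v s))"
        by (simp add: F_def algebra_simps)
      \<comment> \<open>Where \<open>u s \<le> v s\<close>, the bound \<open>upper\<close> makes the
        left side nonpositive; elsewhere \<open>lower\<close> gives the factor
        \<open>L - m\<close>.\<close>
      also have "\<dots> \<le> (L - m) * \<bar>u s - v s\<bar>"
      proof (cases "u s \<le> v s")
        case True
        have "L * (u s - v s) - (P (u s) - P (v s)) \<le> 0"
          using upper[of "u s" "v s"] uv True by (simp add: algebra_simps)
        also have "0 \<le> (L - m) * \<bar>u s - v s\<bar>" using assms by simp
        finally show ?thesis .
      next
        case False
        thus ?thesis using lower[of "v s" "u s"] uv by (simp add: algebra_simps)
      qed
      also have "\<dots> \<le> d" unfolding d_def using D assms by (intro mult_left_mono) auto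
      finally show ?thesis .
    qed
    hence "resolvent k (\<lambda>s. F u s - F v s) \<bar>t\<bar> \<le> resolvent k (\<lambda>_. d) \<bar>t\<bar>"
      by (intro resolvent_mono)
         (use that k Fc Fbd in \<open>auto simp: image_constant_conv intro!: continuous_intros bounded_minus_comp\<close>)
    also have "\<dots> = (1 - m / L) * dist u v"
      using resolvent_const[of k "\<bar>t\<bar>" d] k \<open>L > 0\<close> by (simp add: d_def field_simps)
    finally show ?thesis
      using resolvent_diff[of k "F u" "F v" "\<bar>t\<bar>"] that k Fc Fbd by (simp add: W_def)
  qed
  have "\<exists>!u\<in>S. T u = u"
  proof (rule Banach_fix)
    show "complete S" unfolding S_def complete_eq_closed
      by (rule closed_PiC) auto
    have "const_bcontfun a \<in> S" using \<open>a \<le> b\<close> by (auto simp: S const_bcontfun.rep_eq)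
    thus "S \<noteq> {}" by blast
    show "0 \<le> 1 - m / L" "1 - m / L < 1" using assms by auto
    show "T ` S \<subseteq> S" using Wb T by (auto simp: S)
    show "dist (T u) (T v) \<le> (1 - m / L) * dist u v" if "u \<in> S" "v \<in> S" for u v
    proof (rule dist_bound)
      show "dist (T u t) (T v t) \<le> (1 - m / L) * dist u v" for t
        using le[OF that, of t] le[OF that(2,1), of t] T that
        by (simp add: dist_real_def dist_commute abs_le_iff)
    qed
  qed
  then obtain u where u: "u \<in> S" "T u = u" by blast
  have "W u t = u t" for t
    using T[OF u(1)] u(2) by simp
  hence ut: "resolvent k (F u) t = u t" if "t \<ge> 0" for t
    using that by (metis W_def abs_of_nonneg)
  note D = resolvent_has_derivative[OF k(1) Fc[OF u(1)]]
  \<comment> \<open>At the fixed point the terms \<open>L * u t\<close> cancel, which turns the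
    linear equation back into the nonlinear one.\<close>
  have "k\<^sup>2 * resolvent k (F u) t - F u t = P (resolvent k (F u) t) + G t" if "t \<ge> 0" for t
    using ut[OF that] k by (simp add: F_def)
  with D ut u(1) show ?thesis
    by (intro exI[of _ "resolvent k (F u)"] exI[of _ "resolvent_deriv k (F u)"])
       (auto simp: resolvent_deriv_0 S)
qed

section \<open>Bounded convex functions on the half-line\<close>

text \<open>By convexity \<open>w'\<close> increases from 0; a positive value would force at least
  linear growth from there on, against boundedness.\<close>

lemma bounded_convex_halfline_deriv_0:
  fixes w w' w'' :: "real \<Rightarrow> real"
  assumes w: "\<And>t. t \<ge> 0 \<Longrightarrow> (w has_real_derivative w' t) (at t within {0..})"
    and w': "\<And>t. t \<ge> 0 \<Longrightarrow> (w' has_real_derivative w'' t) (at t within {0..})"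
    and "\<And>t. t \<ge> 0 \<Longrightarrow> w'' t \<ge> 0" "w' 0 = 0" and bdd: "bounded (w ` {0..})" and "t \<ge> 0"
  shows "w' t = 0" 
proof -
  have mvt: "\<exists>z\<in>{x<..<y}. h y - h x = (y - x) * h' z"
    if "\<And>t. t \<ge> 0 \<Longrightarrow> (h has_real_derivative h' t) (at t within {0..})" "0 \<le> x" "x < y"
    for h h' :: "real \<Rightarrow> real" and x y
  proof -
    have "\<exists>z\<in>{x<..<y}. h y - h x = h' z * (y - x)"
      by (rule mvt_simple[OF \<open>x < y\<close>])
         (rule has_derivative_subset[OF that(1)[unfolded has_field_derivative_def]], use \<open>0 \<le> x\<close> in auto)
    thus ?thesis by (simp add: mult.commute)
  qed
  have mono: "w' x \<le> w' y" if "0 \<le> x" "x \<le> y" for x y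
  proof (cases "x = y")
    case False
    with mvt[OF w', of x y] that assms(3) show ?thesis
      by (smt (verit) greaterThanLessThan_iff mult_nonneg_nonneg)
  qed simp
  have "w' t \<le> 0"
  proof (rule ccontr)
    assume "\<not> w' t \<le> 0"
    hence pos: "w' t > 0" by simp
    obtain B where B: "\<And>s. s \<ge> 0 \<Longrightarrow> \<bar>w s\<bar> \<le> B"
      using bdd by (auto simp: bounded_iff)
    \<comment> \<open>Over this length, growth at slope \<open>w' t\<close> amounts to
      \<open>2 * B + 1\<close>, more than the oscillation \<open>2 * B\<close> that the bound
      permits.\<close>
    define y where "y = t + (2 * B + 1) / w' t"
    have "B \<ge> 0" using B[of 0] by simp
    hence "t < y" using pos by (simp add: y_def)
    then obtain z where z: "t < z" "z < y" "w y - w t = (y - t) * w' z"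
      using mvt[OF w, of t y] \<open>t \<ge> 0\<close> by auto
    have "(y - t) * w' t \<le> (y - t) * w' z"
      using mono[of t z] z \<open>t \<ge> 0\<close> by (intro mult_left_mono) auto
    moreover have "(y - t) * w' t = 2 * B + 1" using pos by (simp add: y_def)
    ultimately show False
      using B[of y] B[of t] z \<open>t \<ge> 0\<close> by auto
  qed
  with mono[of 0 t] assms show ?thesis by simp
qed

section \<open>The threshold for the parameter\<close>

text \<open>Writing \<open>lam = 3 * s\<^sup>2\<close> puts the critical points of the cubic at
  \<open>s\<close> and \<open>- s\<close> and makes the threshold in \<open>lambda0\<close> a
  monomial in \<open>s\<close>.\<close>

lemma cubic_at_minimum:
  assumes "s \<ge> 0"
  shows "cubic (3 * s\<^sup>2) (- sqrt (3 * s\<^sup>2 / 3)) = 2 * s ^ 3"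
  using assms by (simp add: cubic_def power2_eq_square power3_eq_cube)

text \<open>The bound must be uniform in \<open>t\<close>, with a gap below
  \<open>2 * s ^ 3\<close>. A value \<open>mu = 3 * r\<^sup>2\<close> strictly between
  \<open>lambda0 g\<close> and \<open>lam\<close> lies outside the set, which gives the bound
  \<open>2 * r ^ 3\<close> with \<open>r < s\<close>.\<close>

lemma lambda0_bound:
  fixes g :: "real \<Rightarrow> real"
  assumes "bounded (g ` {0..})" "lam > lambda0 g"
  obtains s M where "s > 0" "lam = 3 * s\<^sup>2" "M < 2 * s ^ 3" "\<And>t. t \<ge> 0 \<Longrightarrow> \<bar>g t\<bar> \<le> M"
proof -
  define A where "A = {lam. lam \<ge> 0 \<and> (\<exists>t\<ge>0. \<bar>g t\<bar> \<ge> cubic lam (- sqrt (lam / 3)))}"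
  have l0: "lambda0 g = Sup A" by (simp add: lambda0_def A_def)
  have repr: "\<exists>s\<ge>0. x = 3 * s\<^sup>2" if "x \<ge> 0" for x :: real
    using that by (intro exI[of _ "sqrt (x / 3)"]) auto
  obtain B where B: "\<And>t. t \<ge> 0 \<Longrightarrow> \<bar>g t\<bar> \<le> B"
    using assms(1) by (auto simp: bounded_iff)
  have "B \<ge> 0" using B[of 0] by simp
  have "x \<le> 3 * (1 + B)\<^sup>2" if "x \<in> A" for x
  proof -
    obtain s where s: "s \<ge> 0" "x = 3 * s\<^sup>2" using \<open>x \<in> A\<close> repr[of x] by (auto simp: A_def)
    obtain t where "t \<ge> 0" "2 * s ^ 3 \<le> \<bar>g t\<bar>"
      using \<open>x \<in> A\<close> cubic_at_minimum[of s] s by (auto simp: A_def)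
    hence sB: "2 * s ^ 3 \<le> B" using B[of t] by simp
    \<comment> \<open>A crude bound that avoids cube roots: \<open>s\<close> is at most 1 or at most
      \<open>s ^ 3\<close>.\<close>
    have "s \<le> 1 + B"
    proof (cases "s \<le> 1")
      case False
      hence "s \<le> s ^ 3" using power_increasing[of 1 3 s] by simp
      with sB False \<open>B \<ge> 0\<close> show ?thesis by simp
    qed (use \<open>B \<ge> 0\<close> in simp)
    thus ?thesis using s by (simp add: power_mono)
  qed
  hence bdd: "bdd_above A" by (rule bdd_aboveI)
  \<comment> \<open>Membership of 0 makes \<open>Sup A\<close> nonnegative, and so \<open>mu\<close>
    too.\<close>
  have "0 \<in> A" by (auto simp: A_def cubic_def intro: exI[of _ 0])
  hence "0 \<le> Sup A" by (rule cSup_upper[OF _ bdd])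
  define mu where "mu = (lam + Sup A) / 2"
  have mu: "Sup A < mu" "mu < lam" "0 \<le> mu"
    using assms(2) \<open>0 \<le> Sup A\<close> unfolding mu_def l0 by auto
  obtain r where r: "r \<ge> 0" "mu = 3 * r\<^sup>2" using repr mu by blast
  obtain s where s: "s \<ge> 0" "lam = 3 * s\<^sup>2" using repr[of lam] mu by auto
  have "r < s" using mu r s by (simp add: power_less_imp_less_base)
  have "mu \<notin> A" using cSup_upper[OF _ bdd, of mu] mu by auto
  hence "\<bar>g t\<bar> \<le> 2 * r ^ 3" if "t \<ge> 0" for t
    using that mu(3) cubic_at_minimum[of r] r by (metis (mono_tags, lifting) A_def linear mem_Collect_eq)
  moreover have "2 * r ^ 3 < 2 * s ^ 3" using \<open>r < s\<close> r by (simp add: power_strict_mono)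
  moreover have "s > 0" using \<open>r < s\<close> r by simp
  ultimately show ?thesis using that s by blast
qed

section \<open>Uniqueness and existence of the positive solution\<close>

lemma cubic_diff: "cubic lam y - cubic lam x = (y - x) * (y\<^sup>2 + x * y + x\<^sup>2 - lam)"
  by (simp add: cubic_def algebra_simps power2_eq_square power3_eq_cube)

text \<open>Each of the three products is at least the square of the smaller of \<open>x\<close> and
  \<open>y\<close>.\<close>

lemma cubic_quotient_pos:
  fixes x y lam :: real
  assumes "x > 0" "y > 0" "3 * x\<^sup>2 - lam > 0" "3 * y\<^sup>2 - lam > 0"
  shows "y\<^sup>2 + x * y + x\<^sup>2 - lam > 0"
proof -
  have "(min x y)\<^sup>2 \<le> x * y"
    using assms by (auto simp: min_def power2_eq_square)
  thus ?thesis using assms by (auto simp: min_def split: if_splits) 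
qed

text \<open>The difference \<open>z\<close> satisfies \<open>z'' = q * z\<close> with
  \<open>q > 0\<close>, so the second derivative of its square is
  \<open>2 * (z'\<^sup>2 + q * z\<^sup>2)\<close>. Once the square is known to be constant, this
  expression vanishes, and positivity of \<open>q\<close> gives \<open>z = 0\<close>.\<close>

lemma positive_solution_unique:
  fixes g u v :: "real \<Rightarrow> real"
  assumes "\<epsilon> > 0"
    and u: "bounded_neumann_solution \<epsilon> lam g u" "\<And>t. t \<ge> 0 \<Longrightarrow> u t > 0 \<and> 3 * (u t)\<^sup>2 - lam > 0"
    and v: "bounded_neumann_solution \<epsilon> lam g v" "\<And>t. t \<ge> 0 \<Longrightarrow> v t > 0 \<and> 3 * (v t)\<^sup>2 - lam > 0"
    and "t \<ge> 0"
  shows "v t = u t"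
proof -
  obtain u' u'' where u': "\<And>t. t \<ge> 0 \<Longrightarrow> (u has_real_derivative u' t) (at t within {0..})"
    "\<And>t. t \<ge> 0 \<Longrightarrow> (u' has_real_derivative u'' t) (at t within {0..})"
    "\<And>t. t \<ge> 0 \<Longrightarrow> \<epsilon>\<^sup>2 * u'' t = cubic lam (u t) + g t" "u' 0 = 0"
    using u(1) unfolding bounded_neumann_solution_def neumann_solution_def cubic_def by blast
  obtain v' v'' where v': "\<And>t. t \<ge> 0 \<Longrightarrow> (v has_real_derivative v' t) (at t within {0..})"
    "\<And>t. t \<ge> 0 \<Longrightarrow> (v' has_real_derivative v'' t) (at t within {0..})"
    "\<And>t. t \<ge> 0 \<Longrightarrow> \<epsilon>\<^sup>2 * v'' t = cubic lam (v t) + g t" "v' 0 = 0"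
    using v(1) unfolding bounded_neumann_solution_def neumann_solution_def cubic_def by blast
  define z where "z t = v t - u t" for t
  define z' where "z' t = v' t - u' t" for t
  define q where "q t = ((v t)\<^sup>2 + u t * v t + (u t)\<^sup>2 - lam) / \<epsilon>\<^sup>2" for t
  have q: "q t > 0" if "t \<ge> 0" for t
    unfolding q_def using cubic_quotient_pos[of "u t" "v t" lam] u(2)[OF that] v(2)[OF that] \<open>\<epsilon> > 0\<close> by simp
  have zq: "v'' t - u'' t = q t * z t" if "t \<ge> 0" for t
  proof -
    have "\<epsilon>\<^sup>2 * (v'' t - u'' t) = cubic lam (v t) - cubic lam (u t)"
      using u'(3)[OF that] v'(3)[OF that] by (simp add: algebra_simps)
    thus ?thesis
      using \<open>\<epsilon> > 0\<close> by (simp add: cubic_diff q_def z_def field_simps)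
  qed
  have z: "(z has_real_derivative z' t) (at t within {0..})" if "t \<ge> 0" for t
    unfolding z_def[abs_def] z'_def by (intro DERIV_diff u' v' that)
  have z': "(z' has_real_derivative q t * z t) (at t within {0..})" if "t \<ge> 0" for t
    unfolding zq[OF that, symmetric] unfolding z'_def[abs_def] by (intro DERIV_diff u' v' that)
  define w'' where "w'' t = 2 * ((z' t)\<^sup>2 + q t * (z t)\<^sup>2)" for t
  have w: "((\<lambda>t. (z t)\<^sup>2) has_real_derivative 2 * z t * z' t) (at t within {0..})" if "t \<ge> 0" for t
    by (rule derivative_eq_intros z[OF that] refl)+ simp
  have w': "((\<lambda>t. 2 * z t * z' t) has_real_derivative w'' t) (at t within {0..})" if "t \<ge> 0" for t
    by (rule derivative_eq_intros z[OF that] z'[OF that] refl)+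
       (simp add: w''_def algebra_simps power2_eq_square)
  have "bounded (z ` {0..})"
    unfolding z_def[abs_def] using u(1) v(1)
    by (intro bounded_minus_comp) (auto simp: bounded_neumann_solution_def)
  then obtain B where B: "\<And>t. t \<ge> 0 \<Longrightarrow> \<bar>z t\<bar> \<le> B" by (auto simp: bounded_iff)
  have "bounded ((\<lambda>t. (z t)\<^sup>2) ` {0..})"
    unfolding bounded_iff
  proof (intro exI ballI)
    fix x assume "x \<in> (\<lambda>t. (z t)\<^sup>2) ` {0..}"
    then obtain t where "t \<ge> 0" "x = (z t)\<^sup>2" by auto
    thus "norm x \<le> B\<^sup>2" using power_mono[OF B[of t], of 2] by simp
  qed
  moreover have "w'' t \<ge> 0" if "t \<ge> 0" for t
    using q[OF that] by (simp add: w''_def)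
  moreover have "2 * z 0 * z' 0 = 0"
    by (simp add: z'_def u'(4) v'(4))
  ultimately have w'0: "2 * z t * z' t = 0" if "t \<ge> 0" for t
    using bounded_convex_halfline_deriv_0[OF w w' _ _ _ that] by blast
  \<comment> \<open>The first derivative of the square vanishes on the half-line, so
    \<open>w'' t\<close> is also a derivative of the zero function.\<close>
  have "((\<lambda>_. 0) has_real_derivative w'' t) (at t within {0..})"
    using w'[OF \<open>t \<ge> 0\<close>] by (rule has_field_derivative_transform_within[OF _ zero_less_one])
      (use w'0 \<open>t \<ge> 0\<close> in auto)
  \<comment> \<open>Derivatives within a set are unique only at its limit points; the half-line is
    connected and not a single point.\<close>
  moreover have "at t within {0..} \<noteq> bot"
    unfolding trivial_limit_within
    using connected_imp_perfect[of "{0..}" t] infinite_Ici[of "0 :: real"] \<open>t \<ge> 0\<close>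
    by (metis atLeast_iff connected_Ici finite.emptyI finite.insertI)
  ultimately have "w'' t = 0"
    using vector_derivative_unique_within[of t "{0..}" "\<lambda>_. 0" "w'' t" 0]
    by (simp add: has_real_derivative_iff_has_vector_derivative)
  hence "q t * (z t)\<^sup>2 = 0"
    using q[OF \<open>t \<ge> 0\<close>] mult_nonneg_nonneg[of "q t" "(z t)\<^sup>2"] zero_le_power2[of "z' t"]
    unfolding w''_def by (smt (verit) zero_le_power2)
  thus ?thesis using q[OF \<open>t \<ge> 0\<close>] by (simp add: z_def)
qed

lemma ex1_positive_solution:
  fixes g :: "real \<Rightarrow> real"
  assumes g: "continuous_on {0..} g"
    and "bounded (g ` {0..})"
    and "lam > lambda0 g"
    and "\<epsilon> > 0"
  shows "ex1_halfline (\<lambda>u. bounded_neumann_solution \<epsilon> lam g u \<and>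
           (\<forall>t\<ge>0. u t > 0 \<and> 3 * (u t)\<^sup>2 - lam > 0))"
proof -
  obtain s M where s: "s > 0" "lam = 3 * s\<^sup>2" and M: "M < 2 * s ^ 3" "\<And>t. t \<ge> 0 \<Longrightarrow> \<bar>g t\<bar> \<le> M"
    using lambda0_bound[OF assms(2,3)] by blast
  have "M \<ge> 0" using M(2)[of 0] by simp
  \<comment> \<open>Besides \<open>- s\<close>, this is the point where the cubic takes its local
    maximum value \<open>2 * s ^ 3\<close>.\<close>
  define b where "b = 2 * s"
  have ps: "cubic lam s = - 2 * s ^ 3" and pb: "cubic lam b = 2 * s ^ 3"
    by (simp_all add: s b_def cubic_def power2_eq_square power3_eq_cube)
  have cont: "continuous_on S (cubic lam)" for S
    unfolding cubic_def[abs_def] by (intro continuous_intros)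
  obtain a where a: "s \<le> a" "a \<le> b" "cubic lam a = - M"
    using IVT'[of "cubic lam" s "- M" b] ps pb M(1) \<open>M \<ge> 0\<close> s(1) cont by (auto simp: b_def)
  \<comment> \<open>Strictness matters: it makes the lower slope bound
    \<open>3 * a\<^sup>2 - lam\<close> positive, hence the map a contraction.\<close>
  have "s < a" using a ps M(1) by (cases "s = a") auto
  have "s\<^sup>2 < a\<^sup>2" "a\<^sup>2 \<le> b\<^sup>2" using \<open>s < a\<close> a s by (auto intro: power_strict_mono power_mono)
  \<comment> \<open>These bounds on the quotient in \<open>cubic_diff\<close> supply the slope
    bounds \<open>m\<close> and \<open>L\<close>, up to division by
    \<open>\<epsilon>\<^sup>2\<close>.\<close>
  have quot: "3 * a\<^sup>2 \<le> y\<^sup>2 + x * y + x\<^sup>2 \<and> y\<^sup>2 + x * y + x\<^sup>2 \<le> 3 * b\<^sup>2" if "a \<le> x" "x \<le> y" "y \<le> b" for x y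
    using mult_mono[of a x a x] mult_mono[of a y a y] mult_mono[of a x a y]
      mult_mono[of x b x b] mult_mono[of y b y b] mult_mono[of x b y b] that s a
    by (auto simp: power2_eq_square)
  have "\<exists>u u'. (\<forall>t\<ge>0. (u has_real_derivative u' t) (at t within {0..})) \<and>
    (\<forall>t\<ge>0. (u' has_real_derivative cubic lam (u t) / \<epsilon>\<^sup>2 + g t / \<epsilon>\<^sup>2) (at t within {0..})) \<and>
    u' 0 = 0 \<and> (\<forall>t\<ge>0. a \<le> u t \<and> u t \<le> b)"
  proof (rule ex_solution_between_barriers)
    show "0 < (3 * a\<^sup>2 - lam) / \<epsilon>\<^sup>2" "(3 * a\<^sup>2 - lam) / \<epsilon>\<^sup>2 \<le> (3 * b\<^sup>2 - lam) / \<epsilon>\<^sup>2"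
      using \<open>s\<^sup>2 < a\<^sup>2\<close> \<open>a\<^sup>2 \<le> b\<^sup>2\<close> s \<open>\<epsilon> > 0\<close> by (simp_all add: divide_right_mono)
    fix x y assume xy: "a \<le> x" "x \<le> y" "y \<le> b"
    have eq: "cubic lam y / \<epsilon>\<^sup>2 - cubic lam x / \<epsilon>\<^sup>2 = (y\<^sup>2 + x * y + x\<^sup>2 - lam) / \<epsilon>\<^sup>2 * (y - x)"
      by (simp add: cubic_diff flip: diff_divide_distrib)
    show "(3 * a\<^sup>2 - lam) / \<epsilon>\<^sup>2 * (y - x) \<le> cubic lam y / \<epsilon>\<^sup>2 - cubic lam x / \<epsilon>\<^sup>2"
      "cubic lam y / \<epsilon>\<^sup>2 - cubic lam x / \<epsilon>\<^sup>2 \<le> (3 * b\<^sup>2 - lam) / \<epsilon>\<^sup>2 * (y - x)"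
      unfolding eq using quot[OF xy] xy by (auto intro!: mult_right_mono divide_right_mono)
  next
    fix t :: real assume "t \<ge> 0"
    thus "cubic lam a / \<epsilon>\<^sup>2 + g t / \<epsilon>\<^sup>2 \<le> 0" "0 \<le> cubic lam b / \<epsilon>\<^sup>2 + g t / \<epsilon>\<^sup>2"
      unfolding add_divide_distrib[symmetric] using M(2)[of t] M(1) a(3) pb
      by (auto intro!: divide_nonpos_nonneg divide_nonneg_nonneg)
  qed (use a \<open>\<epsilon> > 0\<close> in \<open>auto intro!: continuous_intros cont g\<close>)
  then obtain u u' where
    u: "\<And>t. t \<ge> 0 \<Longrightarrow> (u has_real_derivative u' t) (at t within {0..})"
    "\<And>t. t \<ge> 0 \<Longrightarrow> (u' has_real_derivative cubic lam (u t) / \<epsilon>\<^sup>2 + g t / \<epsilon>\<^sup>2) (at t within {0..})"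
    "u' 0 = 0" "\<And>t. t \<ge> 0 \<Longrightarrow> a \<le> u t" "\<And>t. t \<ge> 0 \<Longrightarrow> u t \<le> b"
    by blast
  have "neumann_solution \<epsilon> lam g u"
    unfolding neumann_solution_def
    by (rule exI[of _ u'], rule exI[of _ "\<lambda>t. cubic lam (u t) / \<epsilon>\<^sup>2 + g t / \<epsilon>\<^sup>2"])
       (use u \<open>\<epsilon> > 0\<close> in \<open>auto simp: cubic_def field_simps\<close>)
  moreover have "bounded (u ` {0..})"
    by (rule bounded_subset[of "{a..b}"]) (use u in auto)
  moreover have "u t > 0 \<and> 3 * (u t)\<^sup>2 - lam > 0" if "t \<ge> 0" for t
    using u(4)[OF that] \<open>s < a\<close> s power_strict_mono[of s "u t" 2] by auto
  ultimately have u: "bounded_neumann_solution \<epsilon> lam g u"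
    "\<And>t. t \<ge> 0 \<Longrightarrow> u t > 0 \<and> 3 * (u t)\<^sup>2 - lam > 0"
    by (simp_all add: bounded_neumann_solution_def)
  show ?thesis
    unfolding ex1_halfline_def
  proof (intro exI[of _ u] conjI allI impI; (elim conjE)?)
    fix v and t :: real
    assume "bounded_neumann_solution \<epsilon> lam g v" "\<forall>t\<ge>0. v t > 0 \<and> 3 * (v t)\<^sup>2 - lam > 0" "t \<ge> 0"
    thus "v t = u t"
      using positive_solution_unique[OF \<open>\<epsilon> > 0\<close> u] by blast
  qed (use u in auto)
qed

section \<open>Reflection and the negative solution\<close>

lemma bounded_neumann_solution_minus:
  assumes "bounded_neumann_solution \<epsilon> lam g u"
  shows "bounded_neumann_solution \<epsilon> lam (\<lambda>t. - g t) (\<lambda>t. - u t)"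
proof -
  obtain u' u'' where u': "\<And>t. t \<ge> 0 \<Longrightarrow> (u has_real_derivative u' t) (at t within {0..})"
    "\<And>t. t \<ge> 0 \<Longrightarrow> (u' has_real_derivative u'' t) (at t within {0..})"
    "\<And>t. t \<ge> 0 \<Longrightarrow> \<epsilon>\<^sup>2 * u'' t = u t ^ 3 - lam * u t + g t" "u' 0 = 0"
    using assms unfolding bounded_neumann_solution_def neumann_solution_def by blast
  have "neumann_solution \<epsilon> lam (\<lambda>t. - g t) (\<lambda>t. - u t)"
    unfolding neumann_solution_def
    by (rule exI[of _ "\<lambda>t. - u' t"], rule exI[of _ "\<lambda>t. - u'' t"])
       (use u' in \<open>auto intro!: DERIV_minus\<close>)
  moreover have "bounded ((\<lambda>t. - u t) ` {0..})"
    using assms by (simp add: bounded_neumann_solution_def)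
  ultimately show ?thesis by (simp add: bounded_neumann_solution_def)
qed

theorem proposition4:
  fixes g :: "real \<Rightarrow> real" and lam \<epsilon> :: real
  assumes "continuous_on {0..} g"
    and "bounded (g ` {0..})"
    and "lam > lambda0 g"
    and "\<epsilon> > 0"
  shows "ex1_halfline (\<lambda>u. bounded_neumann_solution \<epsilon> lam g u \<and>
           (\<forall>t\<ge>0. u t > 0 \<and> 3 * (u t)\<^sup>2 - lam > 0)) \<and>
         ex1_halfline (\<lambda>u. bounded_neumann_solution \<epsilon> lam g u \<and>
           (\<forall>t\<ge>0. u t < 0 \<and> 3 * (u t)\<^sup>2 - lam > 0))"
proof
  show "ex1_halfline (\<lambda>u. bounded_neumann_solution \<epsilon> lam g u \<and>
           (\<forall>t\<ge>0. u t > 0 \<and> 3 * (u t)\<^sup>2 - lam > 0))"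
    by (rule ex1_positive_solution[OF assms])
  have "bounded ((\<lambda>t. - g t) ` {0..})"
    using assms(2) by simp
  \<comment> \<open>Only the absolute value of \<open>g\<close> enters, so reflection keeps the
    threshold.\<close>
  moreover have "lambda0 (\<lambda>t. - g t) = lambda0 g"
    by (simp add: lambda0_def)
  ultimately have "ex1_halfline (\<lambda>u. bounded_neumann_solution \<epsilon> lam (\<lambda>t. - g t) u \<and>
           (\<forall>t\<ge>0. u t > 0 \<and> 3 * (u t)\<^sup>2 - lam > 0))"
    using assms by (intro ex1_positive_solution continuous_on_minus) auto
  then obtain u where u: "bounded_neumann_solution \<epsilon> lam (\<lambda>t. - g t) u"
    "\<And>t. t \<ge> 0 \<Longrightarrow> u t > 0 \<and> 3 * (u t)\<^sup>2 - lam > 0"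
    "\<And>v t. bounded_neumann_solution \<epsilon> lam (\<lambda>t. - g t) v \<Longrightarrow>
       (\<And>t. t \<ge> 0 \<Longrightarrow> v t > 0 \<and> 3 * (v t)\<^sup>2 - lam > 0) \<Longrightarrow> t \<ge> 0 \<Longrightarrow> v t = u t"
    unfolding ex1_halfline_def by blast
  show "ex1_halfline (\<lambda>u. bounded_neumann_solution \<epsilon> lam g u \<and>
           (\<forall>t\<ge>0. u t < 0 \<and> 3 * (u t)\<^sup>2 - lam > 0))"
    unfolding ex1_halfline_def
  proof (intro exI[of _ "\<lambda>t. - u t"] conjI allI impI; (elim conjE)?)
    show "bounded_neumann_solution \<epsilon> lam g (\<lambda>t. - u t)"
      using bounded_neumann_solution_minus[OF u(1)] by simp
    fix v and t :: real
    assume v: "bounded_neumann_solution \<epsilon> lam g v"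
      "\<forall>t\<ge>0. v t < 0 \<and> 3 * (v t)\<^sup>2 - lam > 0" and "t \<ge> 0"
    \<comment> \<open>The reflection of \<open>v\<close> is a positive solution for
      \<open>- g\<close>, hence equal to \<open>u\<close>.\<close>
    show "v t = - u t"
      using u(3)[OF bounded_neumann_solution_minus[OF v(1)] _ \<open>t \<ge> 0\<close>] v(2) by simp
  qed (use u(2) in auto)
qed

end
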